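(* For $n\ge 1$, $s\in\mathbb{C}$ and $z\in\mathbb{C}$ with $\Re(z)>0$, let $\phi_j(s,z)=z+e^{(s-j)z}$ and $$\Upsilon_n(s,z)=\phi_1\big(s,\phi_2(s,\dots\phi_n(s,z)\dots)\big).$$ Then for all $s\in\mathbb{C}$ and all $z$ with $\Re(z)>0$ the infinite composition $$\Upsilon(s,z)=\lim_{n\to\infty}\Upsilon_n(s,z)$$ converges. For each fixed $z$ with $\Re(z)>0$, the function $s\mapsto\Upsilon(s,z)$ is entire and satisfies $$\Upsilon(s+1,z)-\Upsilon(s,z)=e^{s\,\Upsilon(s,z)}\qquad\text{for all } s\in\mathbb{C}.$$ Moreover, $\Upsilon(s,z)$ is holomorphic in $z$ for $\Re(z)>0$.
   Context: The composition is taken in the second variable only, with $s$ held fixed: each $\phi_j(s,\cdot)$ is an entire function $\mathbb{C}\to\mathbb{C}$, and $\Upsilon_n(s,\cdot)=\phi_1(s,\cdot)\circ\phi_2(s,\cdot)\circ\cdots\circ\phi_n(s,\cdot)$, new terms being added on the inside. The variable $z$ plays the role of a parameter. *)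

theory Defs
  imports "HOL-Complex_Analysis.Complex_Analysis"
begin

definition phi :: "nat \<Rightarrow> complex \<Rightarrow> complex \<Rightarrow> complex" where
  "phi j s z = z + exp ((s - of_nat j) * z)"

text \<open>
  The composition runs over \<open>z\<close> with \<open>s\<close> fixed, and new factors enter on the inside:
  \<open>Upsilon_n n s = phi 1 s \<circ> phi 2 s \<circ> \<dots> \<circ> phi n s\<close>.
  The empty composition \<open>n = 0\<close> is the identity.
\<close>

primrec Upsilon_n :: "nat \<Rightarrow> complex \<Rightarrow> complex \<Rightarrow> complex" where
  "Upsilon_n 0 s = id"
| "Upsilon_n (Suc n) s = Upsilon_n n s \<circ> phi (Suc n) s"

text \<open>
  The value is meaningful only where the sequence converges, as \<open>lim\<close> is total.
\<close>

definition Upsilon :: "complex \<Rightarrow> complex \<Rightarrow> complex" where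
  "Upsilon s z = lim (\<lambda>n. Upsilon_n n s z)"

end

theory Submission
  imports Defs
begin

text \<open>
  For \<open>s\<close> bounded by \<open>R\<close> and \<open>w\<close> in the convex region \<open>Re w \<ge> \<delta>\<close>, \<open>\<bar>w\<bar> \<le> M\<close>, the map \<open>phi j s\<close> moves
  \<open>w\<close> by at most \<open>A j\<close> and has Lipschitz constant at most \<open>1 + A j\<close>, with \<open>A j = O(j exp (-\<delta> j))\<close>
  summable. If the factors of index at most \<open>N\<close> are split off so that the tail sum of \<open>A\<close> is small,
  compositions of the remaining ones keep a compact set inside the region and share a Lipschitz
  constant, so inserting the next factor on the inside changes them by \<open>O(A j)\<close> and they converge
  uniformly. The first \<open>N\<close> factors are uniformly continuous on compact sets, so \<open>Upsilon_n\<close>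
  converges locally uniformly. The difference equation is the limit of
  \<open>Upsilon_n (n + 1) (s + 1) z = phi 0 s (Upsilon_n n s z)\<close>, as \<open>phi (j + 1) (s + 1) = phi j s\<close>.
\<close>

section \<open>Compositions of near-identity maps in an abstract metric space\<close>

primrec inner_comp :: "(nat \<Rightarrow> 'a \<Rightarrow> 'a) \<Rightarrow> nat \<Rightarrow> 'a \<Rightarrow> 'a" where
  "inner_comp f 0 = id"
| "inner_comp f (Suc n) = inner_comp f n \<circ> f n"

lemma cball_shift_subset:
  fixes y z :: "'a::metric_space"
  assumes "cball z (a + b) \<subseteq> D" "dist y z \<le> a"
  shows "cball y b \<subseteq> D"
proof
  fix w assume "w \<in> cball y b"
  then have "dist z w \<le> a + b"
    using dist_triangle[of z w y] assms(2) by (simp add: dist_commute)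
  then show "w \<in> D" using assms(1) by auto
qed

context
  fixes f :: "nat \<Rightarrow> 'a \<Rightarrow> 'a::metric_space" and D :: "'a set" and a :: "nat \<Rightarrow> real"
  assumes a_nonneg: "\<And>k. 0 \<le> a k"
    and near_id: "\<And>k w. w \<in> D \<Longrightarrow> dist (f k w) w \<le> a k"
    and lip: "\<And>k w w'. w \<in> D \<Longrightarrow> w' \<in> D \<Longrightarrow> dist (f k w) (f k w') \<le> (1 + a k) * dist w w'"
begin

text \<open>The radius is a budget: \<open>f n\<close> acts first in
  \<open>inner_comp f (Suc n)\<close>, spends at most \<open>a n\<close> of it, and leaves its image
  a ball wide enough for the factors of index below \<open>n\<close>. All inductions below run on
  this invariant.\<close>

lemma cball_sum_Suc_subset:
  assumes "cball z (\<Sum>k<Suc n. a k) \<subseteq> D"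
  shows "z \<in> D" "dist (f n z) z \<le> a n" "cball (f n z) (\<Sum>k<n. a k) \<subseteq> D"
proof -
  show zD: "z \<in> D"
    using assms sum_nonneg[of "{..<Suc n}" a] a_nonneg by (auto simp del: sum.lessThan_Suc)
  then show near: "dist (f n z) z \<le> a n" by (rule near_id)
  show "cball (f n z) (\<Sum>k<n. a k) \<subseteq> D"
    by (rule cball_shift_subset[OF _ near]) (use assms in \<open>simp add: add.commute\<close>)
qed

lemma dist_inner_comp:
  assumes "cball z (\<Sum>k<n. a k) \<subseteq> D"
  shows "dist (inner_comp f n z) z \<le> (\<Sum>k<n. a k)"
  using assms
proof (induction n arbitrary: z)
  case (Suc n)
  have "dist (inner_comp f n (f n z)) (f n z) \<le> (\<Sum>k<n. a k)"
    using Suc.IH cball_sum_Suc_subset(3)[OF Suc.prems] by blast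
  then show ?case
    using cball_sum_Suc_subset(2)[OF Suc.prems]
      dist_triangle[of "inner_comp f n (f n z)" z "f n z"] by simp
qed simp

lemma inner_comp_lipschitz:
  assumes "cball z (\<Sum>k<n. a k) \<subseteq> D" "cball z' (\<Sum>k<n. a k) \<subseteq> D"
  shows "dist (inner_comp f n z) (inner_comp f n z') \<le> (\<Prod>k<n. 1 + a k) * dist z z'"
  using assms
proof (induction n arbitrary: z z')
  case (Suc n)
  note z = cball_sum_Suc_subset[OF Suc.prems(1)] and z' = cball_sum_Suc_subset[OF Suc.prems(2)]
  have "dist (inner_comp f n (f n z)) (inner_comp f n (f n z'))
      \<le> (\<Prod>k<n. 1 + a k) * dist (f n z) (f n z')"
    by (rule Suc.IH[OF z(3) z'(3)])
  also have "\<dots> \<le> (\<Prod>k<n. 1 + a k) * ((1 + a n) * dist z z')"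
    using lip[OF z(1) z'(1)] a_nonneg
    by (intro mult_left_mono prod_nonneg) (auto intro: add_nonneg_nonneg)
  finally show ?case by (simp add: mult.assoc)
qed simp

text \<open>Both compositions share the outer factors \<open>f 0\<close>, ...,
  \<open>f (n - 1)\<close> and differ only in the starting point, \<open>f n z\<close> against
  \<open>z\<close>. Bounding the product of Lipschitz constants by the exponential of the sum makes
  the constant independent of \<open>n\<close>.\<close>

lemma dist_inner_comp_Suc:
  assumes "summable a" "cball z (suminf a) \<subseteq> D"
  shows "dist (inner_comp f (Suc n) z) (inner_comp f n z) \<le> exp (suminf a) * a n"
proof -
  have le: "(\<Sum>k<m. a k) \<le> suminf a" for m
    using assms(1) a_nonneg by (intro sum_le_suminf) auto
  have sub: "cball z (\<Sum>k<m. a k) \<subseteq> D" for m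
    using le[of m] assms(2) subset_cball by blast
  note S = cball_sum_Suc_subset[OF sub[of "Suc n"]]
  have "dist (inner_comp f (Suc n) z) (inner_comp f n z) \<le> (\<Prod>k<n. 1 + a k) * dist (f n z) z"
    using inner_comp_lipschitz[OF S(3) sub] by simp
  also have "\<dots> \<le> exp (suminf a) * a n"
  proof (intro mult_mono)
    have "(\<Prod>k<n. 1 + a k) \<le> exp (\<Sum>k<n. a k)"
      by (rule prod_le_exp_sum) (rule a_nonneg)
    then show "(\<Prod>k<n. 1 + a k) \<le> exp (suminf a)"
      using le[of n] by (meson exp_le_cancel_iff order_trans)
  qed (use S(2) in auto)
  finally show ?thesis .
qed

end

lemma uniformly_convergent_inner_comp:
  fixes f :: "'x \<Rightarrow> nat \<Rightarrow> 'a \<Rightarrow> 'a::banach"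
  assumes a: "summable a" "\<And>k. 0 \<le> a k"
    and near: "\<And>x k w. x \<in> X \<Longrightarrow> w \<in> D \<Longrightarrow> dist (f x k w) w \<le> a k"
    and lip: "\<And>x k w w'. x \<in> X \<Longrightarrow> w \<in> D \<Longrightarrow> w' \<in> D \<Longrightarrow>
      dist (f x k w) (f x k w') \<le> (1 + a k) * dist w w'"
    and g: "\<And>x. x \<in> X \<Longrightarrow> cball (g x) (suminf a) \<subseteq> D"
  shows "uniformly_convergent_on X (\<lambda>n x. inner_comp (f x) n (g x))"
proof -
  \<comment> \<open>The increments telescope to the composition minus \<open>g x\<close>, so the
    M-test applies to their sum.\<close>
  define d where "d n x = inner_comp (f x) (Suc n) (g x) - inner_comp (f x) n (g x)" for n x
  have "uniformly_convergent_on X (\<lambda>n x. \<Sum>i<n. d i x)"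
  proof (rule Weierstrass_m_test')
    show "norm (d n x) \<le> exp (suminf a) * a n" if "x \<in> X" for n x
      unfolding d_def dist_norm[symmetric]
      by (rule dist_inner_comp_Suc[of a D]) (use that a near lip g in auto)
    show "summable (\<lambda>n. exp (suminf a) * a n)" using a(1) by (rule summable_mult)
  qed
  then have "uniformly_convergent_on X (\<lambda>n x. (\<Sum>i<n. d i x) + g x)"
    unfolding uniformly_convergent_on_def using uniform_limit_add[OF _ uniform_limit_const] by blast
  moreover have "(\<Sum>i<n. d i x) + g x = inner_comp (f x) n (g x)" for n x
    unfolding d_def by (subst sum_lessThan_telescope) simp
  ultimately show ?thesis by simp
qed

lemma uniformly_convergent_on_seq_offset:
  assumes "uniformly_convergent_on X (\<lambda>n. F (n + N))"
  shows "uniformly_convergent_on X (F :: nat \<Rightarrow> _)"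
  using assms unfolding uniformly_convergent_on_def uniform_limit_iff
  by (simp add: eventually_sequentially_seg[of "\<lambda>n. \<forall>x\<in>X. dist (F n x) (_ x) < _"])

section \<open>Splitting and regularity of the finite compositions\<close>

lemma Upsilon_n_add:
  "Upsilon_n (n + N) s z = Upsilon_n N s (inner_comp (\<lambda>k. phi (Suc (k + N)) s) n z)"
  by (induction n arbitrary: z) auto

text \<open>An arbitrary function \<open>v\<close> in the second slot lets the induction absorb the
  innermost factor into it.\<close>

lemma Upsilon_n_continuous:
  "continuous_on A u \<Longrightarrow> continuous_on A v \<Longrightarrow> continuous_on A (\<lambda>x. Upsilon_n n (u x) (v x))"
proof (induction n arbitrary: v)
  case (Suc n)
  have "continuous_on A (\<lambda>x. phi (Suc n) (u x) (v x))"
    unfolding phi_def by (intro continuous_intros Suc.prems)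
  from Suc.IH[OF Suc.prems(1) this] show ?case by simp
qed simp

lemma Upsilon_n_holomorphic:
  "u holomorphic_on A \<Longrightarrow> v holomorphic_on A \<Longrightarrow> (\<lambda>x. Upsilon_n n (u x) (v x)) holomorphic_on A"
proof (induction n arbitrary: v)
  case (Suc n)
  have "(\<lambda>x. phi (Suc n) (u x) (v x)) holomorphic_on A"
    unfolding phi_def by (intro holomorphic_intros Suc.prems)
  from Suc.IH[OF Suc.prems(1) this] show ?case by simp
qed simp

section \<open>Exponential estimates on a truncated half-plane\<close>

lemma norm_exp_factor_le:
  assumes "norm s \<le> R" "norm w \<le> M" "\<delta> \<le> Re w"
  shows "norm (exp ((s - of_nat j) * w)) \<le> exp (R * M) * exp (- \<delta>) ^ j"
proof -
  have "Re (s * w) \<le> R * M"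
    using complex_Re_le_cmod[of "s * w"] mult_mono[OF assms(1,2)] norm_ge_zero[of s] assms(1)
    by (auto simp: norm_mult)
  moreover have "of_nat j * \<delta> \<le> of_nat j * Re w"
    using assms(3) by (rule mult_left_mono) simp
  ultimately have "Re ((s - of_nat j) * w) \<le> R * M - of_nat j * \<delta>"
    by (simp add: algebra_simps)
  then have "norm (exp ((s - of_nat j) * w)) \<le> exp (R * M - of_nat j * \<delta>)"
    by simp
  then show ?thesis
    by (simp add: exp_diff exp_minus power_inverse divide_inverse exp_of_nat_mult[symmetric])
qed

lemma phi_lipschitz:
  assumes s: "norm s \<le> R"
    and w: "w \<in> {w. \<delta> \<le> Re w} \<inter> cball 0 M" "w' \<in> {w. \<delta> \<le> Re w} \<inter> cball 0 M"
  shows "dist (phi j s w) (phi j s w') \<le>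
    (1 + (R + of_nat j) * (exp (R * M) * exp (- \<delta>) ^ j)) * dist w w'"
  unfolding dist_norm
proof (rule field_differentiable_bound[OF _ _ _ w])
  show "convex ({w. \<delta> \<le> Re w} \<inter> cball 0 M)"
    by (intro convex_Int convex_halfspace_Re_ge convex_cball)
  fix z assume "z \<in> {w. \<delta> \<le> Re w} \<inter> cball 0 M"
  then have e: "norm (exp ((s - of_nat j) * z)) \<le> exp (R * M) * exp (- \<delta>) ^ j"
    using norm_exp_factor_le[OF s] by auto
  show "(phi j s has_field_derivative 1 + (s - of_nat j) * exp ((s - of_nat j) * z))
      (at z within {w. \<delta> \<le> Re w} \<inter> cball 0 M)"
    unfolding phi_def[abs_def] by (auto intro!: derivative_eq_intros)
  have "norm (s - of_nat j) \<le> R + of_nat j"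
    using norm_triangle_ineq4[of s "of_nat j"] s by simp
  then have "norm ((s - of_nat j) * exp ((s - of_nat j) * z))
      \<le> (R + of_nat j) * (exp (R * M) * exp (- \<delta>) ^ j)"
    unfolding norm_mult using e order_trans[OF norm_ge_zero s] by (intro mult_mono) auto
  then show "norm (1 + (s - of_nat j) * exp ((s - of_nat j) * z))
      \<le> 1 + (R + of_nat j) * (exp (R * M) * exp (- \<delta>) ^ j)"
    using norm_triangle_ineq[of 1 "(s - of_nat j) * exp ((s - of_nat j) * z)"] by simp
qed

text \<open>Uniformity jointly in both variables serves holomorphy in \<open>s\<close> and in
  \<open>z\<close> alike; radius \<open>0\<close> freezes \<open>z\<close>.\<close>

lemma uniformly_convergent_Upsilon_n:
  assumes "0 \<le> R" "0 \<le> r" "r < Re z0"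
  shows "uniformly_convergent_on (cball 0 R \<times> cball z0 r) (\<lambda>n x. Upsilon_n n (fst x) (snd x))"
proof -
  define X where "X = cball (0::complex) R \<times> cball z0 r"
  \<comment> \<open>Points of \<open>cball z0 r\<close> have real part at least 2 \<delta> and norm
    at most \<open>M - 1\<close>, so they can move by \<delta> and by 1 respectively without
    violating either constraint of \<open>D\<close>.\<close>
  define \<delta> where "\<delta> = (Re z0 - r) / 2"
  define M where "M = norm z0 + r + 1"
  define D where "D = {w. \<delta> \<le> Re w} \<inter> cball 0 M"
  \<comment> \<open>One sequence serves both purposes: the displacement needs a prefactor of at
    least 1, the Lipschitz excess needs \<open>R + j\<close>.\<close>
  define A where "A j = (1 + R + real j) * (exp (R * M) * exp (- \<delta>) ^ j)" for j
  have \<delta>: "\<delta> > 0" using assms by (simp add: \<delta>_def)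
  have A_nonneg: "A j \<ge> 0" for j unfolding A_def using assms by simp
  have summable_A: "summable (\<lambda>j. A (Suc j))"
  proof -
    \<comment> \<open>\<open>A\<close> combines a geometric series of ratio below 1 with its
      termwise derivative.\<close>
    have "summable (\<lambda>j. of_nat (Suc j) * exp (- \<delta>) ^ j)" "summable (\<lambda>j. exp (- \<delta>) ^ j)"
      using \<delta> sums_summable[OF geometric_deriv_sums[of "exp (- \<delta>)"]]
      by (auto intro!: summable_geometric)
    then have "summable (\<lambda>j. exp (R * M) * (R * exp (- \<delta>) ^ j + of_nat (Suc j) * exp (- \<delta>) ^ j))"
      by (intro summable_mult summable_add)
    also have "(\<lambda>j. exp (R * M) * (R * exp (- \<delta>) ^ j + of_nat (Suc j) * exp (- \<delta>) ^ j)) = A"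
      by (auto simp: A_def algebra_simps)
    finally show ?thesis by (subst summable_Suc_iff)
  qed
  \<comment> \<open>The total displacement of the tail has to fit both margins of
    \<open>D\<close>.\<close>
  have "min \<delta> 1 > 0" using \<delta> by simp
  from suminf_exist_split[OF this summable_A]
  obtain N where "norm (\<Sum>k. A (Suc (k + N))) < min \<delta> 1" by blast
  then have tail: "(\<Sum>k. A (Suc (k + N))) \<le> \<delta>" "(\<Sum>k. A (Suc (k + N))) \<le> 1" by auto
  define a where "a k = A (Suc (k + N))" for k
  have a: "summable a" "\<And>k. 0 \<le> a k"
    unfolding a_def using summable_ignore_initial_segment[OF summable_A, of N] A_nonneg by auto
  define f where "f x k = phi (Suc (k + N)) (fst x)" for x :: "complex \<times> complex" and k
  define T where "T n x = inner_comp (f x) n (snd x)" for n x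
  have near: "dist (f x k w) w \<le> a k" if "x \<in> X" "w \<in> D" for x k w
  proof -
    have "dist (f x k w) w \<le> exp (R * M) * exp (- \<delta>) ^ Suc (k + N)"
      using norm_exp_factor_le[of "fst x" R w M \<delta> "Suc (k + N)"] that
      by (auto simp: f_def phi_def dist_norm X_def D_def simp del: power_Suc of_nat_Suc)
    also have "\<dots> \<le> (1 + R + real (Suc (k + N))) * (exp (R * M) * exp (- \<delta>) ^ Suc (k + N))"
      using assms by (subst mult_le_cancel_right1) (auto simp: mult_less_0_iff)
    finally show ?thesis by (simp only: a_def A_def)
  qed
  have lip: "dist (f x k w) (f x k w') \<le> (1 + a k) * dist w w'"
    if "x \<in> X" "w \<in> D" "w' \<in> D" for x k w w'
  proof -
    have "dist (f x k w) (f x k w') \<le> (1 + (R + of_nat (Suc (k + N))) *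
        (exp (R * M) * exp (- \<delta>) ^ Suc (k + N))) * dist w w'"
      unfolding f_def by (rule phi_lipschitz) (use that in \<open>auto simp: X_def D_def\<close>)
    also have "\<dots> \<le> (1 + a k) * dist w w'"
      unfolding a_def A_def by (intro mult_right_mono add_left_mono) auto
    finally show ?thesis .
  qed
  have g: "cball (snd x) (suminf a) \<subseteq> D" if "x \<in> X" for x
  proof
    fix w assume "w \<in> cball (snd x) (suminf a)"
    then have w: "norm (snd x - w) \<le> \<delta>" "norm (snd x - w) \<le> 1"
      using tail unfolding a_def[abs_def, symmetric] by (auto simp: dist_norm)
    have x: "norm (z0 - snd x) \<le> r" using that by (auto simp: X_def dist_norm)
    have "Re z0 - Re w \<le> \<delta> + r"
      using complex_Re_le_cmod[of "z0 - snd x"] complex_Re_le_cmod[of "snd x - w"] x w by simp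
    moreover have "norm w \<le> M"
      using norm_triangle_ineq4[of z0 "z0 - w"] norm_triangle_ineq[of "z0 - snd x" "snd x - w"] x w
      by (simp add: M_def)
    ultimately show "w \<in> D" by (simp add: D_def \<delta>_def field_simps)
  qed
  have "uniformly_convergent_on X T"
    unfolding T_def by (rule uniformly_convergent_inner_comp[OF a near lip g])
  then obtain t where t: "uniform_limit X T t sequentially"
    by (auto simp: uniformly_convergent_on_def)
  \<comment> \<open>The tail compositions and their limit must lie in one compact set, on which the
    first \<open>N\<close> factors are uniformly continuous.\<close>
  have T_bound: "T n x \<in> cball 0 M" if "x \<in> X" for n x
  proof -
    have le: "(\<Sum>k<n. a k) \<le> suminf a" using a by (intro sum_le_suminf) auto
    then have "cball (snd x) (\<Sum>k<n. a k) \<subseteq> D" using g[OF that] subset_cball by blast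
    then have "dist (T n x) (snd x) \<le> (\<Sum>k<n. a k)"
      unfolding T_def
      by (rule dist_inner_comp[of a D "f x", rotated -1]) (use a near lip that in auto)
    then have "T n x \<in> cball (snd x) (suminf a)" using le by (simp add: dist_commute)
    then show ?thesis using g[OF that] by (auto simp: D_def)
  qed
  have t_bound: "t x \<in> cball 0 M" if "x \<in> X" for x
    using closed_sequentially[OF closed_cball _ tendsto_uniform_limitI[OF t that]] T_bound[OF that]
    by blast
  \<comment> \<open>The outer factors depend on \<open>s\<close> as well, so \<open>s\<close> is
    carried along and uniform continuity is used jointly on a compact product.\<close>
  have "uniform_limit X (\<lambda>n x. (fst x, T n x)) (\<lambda>x. (fst x, t x)) sequentially"
    using t by (simp add: uniform_limit_iff dist_Pair_Pair)
  moreover have "uniformly_continuous_on (cball 0 R \<times> cball 0 M) (\<lambda>p. Upsilon_n N (fst p) (snd p))"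
    by (intro compact_uniformly_continuous Upsilon_n_continuous compact_Times compact_cball
        continuous_intros)
  ultimately have "uniform_limit X (\<lambda>n x. Upsilon_n N (fst (fst x, T n x)) (snd (fst x, T n x)))
      ((\<lambda>p. Upsilon_n N (fst p) (snd p)) \<circ> (\<lambda>x. (fst x, t x))) sequentially"
    using T_bound t_bound
    by (intro uniform_limit_compose always_eventually) (auto simp: X_def)
  then have "uniformly_convergent_on X (\<lambda>n x. Upsilon_n (n + N) (fst x) (snd x))"
    unfolding uniformly_convergent_on_def Upsilon_n_add T_def f_def by auto
  then show ?thesis
    unfolding X_def by (rule uniformly_convergent_on_seq_offset)
qed

section \<open>The limit function: convergence, holomorphy and the difference equation\<close>

lemma uniform_limit_Upsilon:
  assumes "0 \<le> R" "0 \<le> r" "r < Re z0"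
  shows "uniform_limit (cball 0 R \<times> cball z0 r)
    (\<lambda>n x. Upsilon_n n (fst x) (snd x)) (\<lambda>x. Upsilon (fst x) (snd x)) sequentially"
  using uniformly_convergent_Upsilon_n[OF assms]
  unfolding uniformly_convergent_uniform_limit_iff Upsilon_def .

lemma Upsilon_n_tendsto:
  assumes "Re z > 0"
  shows "(\<lambda>n. Upsilon_n n s z) \<longlonglongrightarrow> Upsilon s z"
  using tendsto_uniform_limitI[OF uniform_limit_Upsilon[of "norm s" 0 z], of "(s, z)"] assms
  by simp

lemma Upsilon_holomorphic_left:
  assumes "Re z > 0"
  shows "(\<lambda>s. Upsilon s z) holomorphic_on UNIV"
proof (rule holomorphic_uniform_sequence)
  show "(\<lambda>s. Upsilon_n n s z) holomorphic_on UNIV" for n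
    by (intro Upsilon_n_holomorphic holomorphic_intros)
  fix s :: complex
  \<comment> \<open>This places the unit disc around \<open>s\<close> inside the disc about 0 on
    which convergence is uniform.\<close>
  have "norm s' \<le> norm s + 1" if "dist s s' \<le> 1" for s'
    using that norm_triangle_sub[of s' s] by (simp add: dist_norm norm_minus_commute)
  then have "uniform_limit (cball s 1) (\<lambda>n s. Upsilon_n n s z) (\<lambda>s. Upsilon s z) sequentially"
    using uniform_limit_compose'[OF uniform_limit_Upsilon[of "norm s + 1" 0 z],
        of "\<lambda>s. (s, z)" "cball s 1"] assms
    by auto
  then show "\<exists>d>0. cball s d \<subseteq> UNIV \<and>
      uniform_limit (cball s d) (\<lambda>n s. Upsilon_n n s z) (\<lambda>s. Upsilon s z) sequentially"
    by (intro exI[of _ 1]) auto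
qed auto

lemma Upsilon_holomorphic_right:
  "(\<lambda>z. Upsilon s z) holomorphic_on {z. Re z > 0}"
proof (rule holomorphic_uniform_sequence)
  show "(\<lambda>z. Upsilon_n n s z) holomorphic_on {z. Re z > 0}" for n
    by (intro Upsilon_n_holomorphic holomorphic_intros)
  fix z :: complex assume "z \<in> {z. Re z > 0}"
  then have z: "Re z > 0" by simp
  \<comment> \<open>Half of \<open>Re z\<close> as radius keeps the closed disc inside the open
    half-plane.\<close>
  have "uniform_limit (cball z (Re z / 2)) (\<lambda>n. Upsilon_n n s) (Upsilon s) sequentially"
    using uniform_limit_compose'[OF uniform_limit_Upsilon[of "norm s" "Re z / 2" z],
        of "\<lambda>z. (s, z)" "cball z (Re z / 2)"] z
    by (auto simp: dist_norm)
  moreover have "cball z (Re z / 2) \<subseteq> {z. Re z > 0}"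
  proof
    fix w assume "w \<in> cball z (Re z / 2)"
    then show "w \<in> {z. Re z > 0}"
      using complex_Re_le_cmod[of "z - w"] z by (simp add: dist_norm)
  qed
  ultimately show "\<exists>d>0. cball z d \<subseteq> {z. Re z > 0} \<and>
      uniform_limit (cball z d) (\<lambda>n. Upsilon_n n s) (Upsilon s) sequentially"
    using z by (intro exI[of _ "Re z / 2"]) auto
qed (rule open_halfspace_Re_gt)

text \<open>Raising both the index and \<open>s\<close> by one leaves the exponent
  \<open>s - j\<close> unchanged, so the inner factors agree. The extra outermost factor is
  \<open>phi 1 (s + 1) w = w + exp (s * w)\<close>, which is the base case.\<close>

lemma Upsilon_n_shift:
  "Upsilon_n (Suc n) (s + 1) z = Upsilon_n n s z + exp (s * Upsilon_n n s z)"
proof (induction n arbitrary: z)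
  case (Suc n)
  have "phi (Suc (Suc n)) (s + 1) z = phi (Suc n) s z"
    by (simp add: phi_def algebra_simps)
  then show ?case
    using Suc.IH[of "phi (Suc n) s z"] by simp
qed (simp add: phi_def)

lemma Upsilon_difference_equation:
  assumes "Re z > 0"
  shows "Upsilon (s + 1) z - Upsilon s z = exp (s * Upsilon s z)"
proof -
  note lim = Upsilon_n_tendsto[OF assms]
  \<comment> \<open>Computing the limit of the shifted sequence in two ways gives the
    equation.\<close>
  have "(\<lambda>n. Upsilon_n (Suc n) (s + 1) z) \<longlonglongrightarrow> Upsilon s z + exp (s * Upsilon s z)"
    unfolding Upsilon_n_shift by (intro tendsto_intros lim)
  moreover have "(\<lambda>n. Upsilon_n (Suc n) (s + 1) z) \<longlonglongrightarrow> Upsilon (s + 1) z"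
    by (rule LIMSEQ_Suc[OF lim])
  ultimately show ?thesis using LIMSEQ_unique by fastforce
qed

theorem theorem4p2:
  shows "(\<forall>s z. Re z > 0 \<longrightarrow> convergent (\<lambda>n. Upsilon_n n s z)) \<and>
    (\<forall>z. Re z > 0 \<longrightarrow>
      (\<lambda>s. Upsilon s z) holomorphic_on UNIV \<and>
      (\<forall>s. Upsilon (s + 1) z - Upsilon s z = exp (s * Upsilon s z))) \<and>
    (\<forall>s. (\<lambda>z. Upsilon s z) holomorphic_on {z. Re z > 0})"
  using convergentI[OF Upsilon_n_tendsto] Upsilon_holomorphic_left Upsilon_difference_equation
    Upsilon_holomorphic_right by blast

end
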